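(* There exists a homeomorphism $f$ of the closed annulus $\overline{\mathbb{A}}=(\mathbb{R}/\mathbb{Z})\times[0,1]$ which is isotopic to the identity, such that $\mathbb{A}=(\mathbb{R}/\mathbb{Z})\times(0,1)$ is a Birkhoff region of instability for $f$, and such that $f$ has a lift $\widehat f$ to $\mathbb{R}\times[0,1]$ satisfying: (i) $\mathrm{Rot}(\widehat f)=[0,1]$; and (ii) for every real number $L>0$ there exist a point $\widehat z\in\mathbb{R}\times[0,1]$ and an integer $n\ge 1$ such that $p_1(\widehat f^{\,n}(\widehat z))-p_1(\widehat z)<-L$.
   Context: The universal covering of $\overline{\mathbb{A}}$ is $\widehat\pi:\mathbb{R}\times[0,1]\to\overline{\mathbb{A}}$, $\widehat\pi(x,y)=(x+\mathbb{Z},y)$, and $p_1:\mathbb{R}\times[0,1]\to\mathbb{R}$ is the projection on the first coordinate. For an $f$-invariant Borel probability measure $\mu$, $\mathrm{Rot}(\widehat f,\mu)=\int_{\overline{\mathbb{A}}}\big(p_1(\widehat f(\widehat z))-p_1(\widehat z)\big)\,d\mu(z)$, with $\widehat z\in\widehat\pi^{-1}(z)$ arbitrary. The rotation set $\mathrm{Rot}(\widehat f)$ is the set of rotation numbers of all $f$-invariant Borel probability measures. $\mathbb{A}$ is a Birkhoff region of instability for $f$ if for any neighborhood $U$ of $(\mathbb{R}/\mathbb{Z})\times\{0\}$ and any neighborhood $V$ of $(\mathbb{R}/\mathbb{Z})\times\{1\}$ there are points $x\in U$, $y\in V$ and positive integers $n_1,n_2$ such that $f^{n_1}(x)\in V$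 and $f^{n_2}(y)\in U$. *)

theory Defs
  imports "HOL-Probability.Probability"
begin

text \<open>The circle \<open>\<real>/\<int>\<close> with its quotient topology; \<open>to_circle x\<close> is the class \<open>x + \<int>\<close>.\<close>

quotient_type circle = real / "\<lambda>x y. x - y \<in> \<int>"
  morphisms rep_circle to_circle
proof (rule equivpI)
  show "reflp (\<lambda>x y :: real. x - y \<in> \<int>)"
    by (simp add: reflp_def)
  show "symp (\<lambda>x y :: real. x - y \<in> \<int>)"
    by (metis (no_types, lifting) Ints_minus minus_diff_eq sympI)
  show "transp (\<lambda>x y :: real. x - y \<in> \<int>)"
  proof (rule transpI)
    fix x y z :: real
    assume "x - y \<in> \<int>" "y - z \<in> \<int>"
    then have "(x - y) + (y - z) \<in> \<int>" by (rule Ints_add)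
    then show "x - z \<in> \<int>" by simp
  qed
qed

lemma to_circle_eq_iff: "to_circle x = to_circle y \<longleftrightarrow> x - y \<in> \<int>"
  by (rule circle.abs_eq_iff)

instantiation circle :: topological_space
begin

definition open_circle :: "circle set \<Rightarrow> bool" where
  "open_circle U \<longleftrightarrow> open (to_circle -` U)"

instance
proof
  show "open (UNIV :: circle set)"
    by (simp add: open_circle_def)
next
  fix S T :: "circle set"
  assume "open S" "open T"
  then show "open (S \<inter> T)"
    by (simp add: open_circle_def vimage_Int open_Int)
next
  fix K :: "circle set set"
  assume "\<forall>S\<in>K. open S"
  then show "open (\<Union>K)"
    by (simp add: open_circle_def vimage_Union open_UN)
qed

end

definition closed_annulus :: "(circle \<times> real) set" where
  "closed_annulus = UNIV \<times> {0..1}"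

definition lower_boundary :: "(circle \<times> real) set" where
  "lower_boundary = UNIV \<times> {0}"

definition upper_boundary :: "(circle \<times> real) set" where
  "upper_boundary = UNIV \<times> {1}"

definition strip :: "(real \<times> real) set" where
  "strip = UNIV \<times> {0..1}"

definition covering_proj :: "real \<times> real \<Rightarrow> circle \<times> real" where
  "covering_proj z = (to_circle (fst z), snd z)"

text \<open>Self-maps of the annulus and of the strip are total functions on the ambient types;
  their values outside \<^const>\<open>closed_annulus\<close> and \<^const>\<open>strip\<close> are irrelevant throughout.\<close>

abbreviation annulus_homeo :: "(circle \<times> real \<Rightarrow> circle \<times> real) \<Rightarrow> bool" where
  "annulus_homeo \<equiv> homeomorphic_map (top_of_set closed_annulus) (top_of_set closed_annulus)"

definition isotopic_to_id :: "(circle \<times> real \<Rightarrow> circle \<times> real) \<Rightarrow> bool" where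
  "isotopic_to_id f \<longleftrightarrow>
    homotopic_with annulus_homeo (top_of_set closed_annulus) (top_of_set closed_annulus) id f"

definition annulus_nbhd :: "(circle \<times> real) set \<Rightarrow> (circle \<times> real) set \<Rightarrow> bool" where
  "annulus_nbhd S U \<longleftrightarrow>
    U \<subseteq> closed_annulus \<and> (\<exists>W. openin (top_of_set closed_annulus) W \<and> S \<subseteq> W \<and> W \<subseteq> U)"

definition birkhoff_instability :: "(circle \<times> real \<Rightarrow> circle \<times> real) \<Rightarrow> bool" where
  "birkhoff_instability f \<longleftrightarrow>
    (\<forall>U V. annulus_nbhd lower_boundary U \<longrightarrow> annulus_nbhd upper_boundary V \<longrightarrow>
      (\<exists>x\<in>U. \<exists>y\<in>V. \<exists>n\<^sub>1>0. \<exists>n\<^sub>2>0. (f ^^ n\<^sub>1) x \<in> V \<and> (f ^^ n\<^sub>2) y \<in> U))"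

text \<open>If \<open>f\<close> is a homeomorphism of the annulus, a continuous \<open>F\<close> as below is automatically a
  homeomorphism of the strip.\<close>

definition is_lift ::
  "(circle \<times> real \<Rightarrow> circle \<times> real) \<Rightarrow> (real \<times> real \<Rightarrow> real \<times> real) \<Rightarrow> bool" where
  "is_lift f F \<longleftrightarrow>
    continuous_on strip F \<and> F ` strip \<subseteq> strip \<and>
    (\<forall>z\<in>strip. covering_proj (F z) = f (covering_proj z))"

definition invariant_prob ::
  "(circle \<times> real \<Rightarrow> circle \<times> real) \<Rightarrow> (circle \<times> real) measure \<Rightarrow> bool" where
  "invariant_prob f \<mu> \<longleftrightarrow>
    prob_space \<mu> \<and> sets \<mu> = sets (restrict_space borel closed_annulus) \<and>
    f \<in> measurable \<mu> \<mu> \<and> distr \<mu> \<mu> f = \<mu>"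

text \<open>The choice of the point over \<open>z\<close> is immaterial when \<open>F\<close> lifts a homeomorphism isotopic to
  the identity, since \<open>F\<close> then commutes with \<open>(x, y) \<mapsto> (x + 1, y)\<close>.\<close>

definition displacement :: "(real \<times> real \<Rightarrow> real \<times> real) \<Rightarrow> circle \<times> real \<Rightarrow> real" where
  "displacement F z =
    (let w = (SOME w. w \<in> strip \<and> covering_proj w = z) in fst (F w) - fst w)"

definition rotation_number ::
  "(real \<times> real \<Rightarrow> real \<times> real) \<Rightarrow> (circle \<times> real) measure \<Rightarrow> real" where
  "rotation_number F \<mu> = (\<integral>z. displacement F z \<partial>\<mu>)"

text \<open>The base map \<open>f\<close> is determined by its lift \<open>F\<close> on the annulus; it is kept as an explicit argument.\<close>

definition rotation_set ::
  "(circle \<times> real \<Rightarrow> circle \<times> real) \<Rightarrow> (real \<times> real \<Rightarrow> real \<times> real) \<Rightarrow> real set" where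
  "rotation_set f F = {rotation_number F \<mu> | \<mu>. invariant_prob f \<mu>}"

end

(*
  In the coordinate s = log 2 (y / (1 - y)) on the open annulus, let g tend to infinity as s tends
  to minus infinity, but with g (s + a) - g s tending to 0 for bounded a, and conjugate the map
  (x, s) |-> (x, s + cos (2 pi x)) by the shear (x, s) |-> (x + g s, s). The result extends to the
  closed annulus by the identity on the boundary. Composing it with the twist (x, y) |-> (x + h y, y),
  where h rises from 0 to 1 between the levels s = 0 and s = 1, gives f. As h is an integer at the
  integral levels, the orbits of (g 0, 0) and (1/2 + g 0, 0) are the sheared vertical lines s in Z
  over x = 0 and x = 1/2, run upwards and downwards, so they join the two boundary circles in both
  directions. Climbing from s = -n to s = 0 over x = 0 changes the first coordinate by g 0 - g (-n),
  which is unbounded below. However, the displacement of the lift is the value of h at the image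
  plus the coboundary g o f - g, and a bounded coboundary has integral 0 for every invariant
  measure, so all rotation numbers lie in [0, 1]; mixtures of the point masses at the fixed points
  (0, 0) and (0, 1) attain every such value.
*)

theory Submission
  imports Defs "HOL-Real_Asymp.Real_Asymp"
begin

subsection \<open>Maps of the annulus induced by equivariant maps of the strip\<close>

lemma to_circle_rep_circle [simp]: "to_circle (rep_circle c) = c"
  using Quotient3_abs_rep[OF Quotient3_circle] .

lemma rep_circle_to_circle: "rep_circle (to_circle x) - x \<in> \<int>"
  using to_circle_eq_iff[of "rep_circle (to_circle x)" x] by simp

lemma continuous_on_to_circle: "continuous_on S to_circle"
  by (rule continuous_on_subset[of UNIV])
     (auto simp: continuous_on_open_vimage open_circle_def)

text \<open>The full preimage of the image is the union of the integer translates of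
  \<open>S\<close>, each of them open.\<close>

lemma open_to_circle_image:
  assumes "open S"
  shows "open (to_circle ` S)"
proof -
  have "to_circle -` (to_circle ` S) = (\<Union>n\<in>\<int>. (+) n ` S)"
  proof (intro set_eqI iffI)
    fix x assume "x \<in> to_circle -` (to_circle ` S)"
    then obtain y where "y \<in> S" "x - y \<in> \<int>"
      by (auto simp: to_circle_eq_iff)
    then show "x \<in> (\<Union>n\<in>\<int>. (+) n ` S)"
      by (intro UN_I[of "x - y"]) auto
  next
    fix x assume "x \<in> (\<Union>n\<in>\<int>. (+) n ` S)"
    then obtain n y where "n \<in> \<int>" "y \<in> S" "x = n + y" by auto
    then have "to_circle x = to_circle y" by (simp add: to_circle_eq_iff)
    with \<open>y \<in> S\<close> show "x \<in> to_circle -` (to_circle ` S)" by auto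
  qed
  moreover have "open (\<Union>n\<in>\<int>. (+) n ` S)"
    using assms by (intro open_UN ballI open_translation)
  ultimately show ?thesis by (simp add: open_circle_def)
qed

lemma continuous_on_covering_proj: "continuous_on S covering_proj"
  unfolding covering_proj_def
  by (intro continuous_intros continuous_on_compose2[OF continuous_on_to_circle[of UNIV]]) auto

lemma open_covering_proj_image:
  assumes "open S"
  shows "open (covering_proj ` S)"
proof (rule open_prod_intro)
  fix p assume "p \<in> covering_proj ` S"
  then obtain x y where xy: "(x, y) \<in> S" "p = (to_circle x, y)"
    by (auto simp: covering_proj_def)
  obtain A B where AB: "open A" "open B" "(x, y) \<in> A \<times> B" "A \<times> B \<subseteq> S"
    using open_prod_elim[OF assms xy(1)] by (metis mem_Times_iff)
  have "to_circle ` A \<times> B \<subseteq> covering_proj ` S"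
  proof
    fix q assume "q \<in> to_circle ` A \<times> B"
    then obtain u v where "u \<in> A" "v \<in> B" "q = covering_proj (u, v)"
      by (auto simp: covering_proj_def)
    then show "q \<in> covering_proj ` S" using AB(4) by auto
  qed
  then show "\<exists>A B. open A \<and> open B \<and> p \<in> A \<times> B \<and> A \<times> B \<subseteq> covering_proj ` S"
    using AB xy by (intro exI[of _ "to_circle ` A"] exI[of _ B])
       (auto simp: open_to_circle_image)
qed

text \<open>Openness makes \<open>p\<close> a quotient map over every subset \<open>A\<close>: an
  open \<open>C\<close> that cuts out the preimage of \<open>B\<close> upstairs has an open image
  that cuts it out downstairs.\<close>

lemma continuous_on_open_quotient:
  assumes "\<And>S. open S \<Longrightarrow> open (p ` S)" and "surj p"
    and "continuous_on (p -` A) (f \<circ> p)"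
  shows "continuous_on A f"
  unfolding continuous_on_open_invariant
proof (intro allI impI)
  fix B :: "'c set" assume "open B"
  then obtain C where C: "open C" "C \<inter> p -` A = (f \<circ> p) -` B \<inter> p -` A"
    using assms(3) unfolding continuous_on_open_invariant by blast
  have "p ` C \<inter> A = f -` B \<inter> A"
  proof (intro set_eqI iffI)
    fix z assume "z \<in> p ` C \<inter> A"
    then show "z \<in> f -` B \<inter> A" using C(2) by auto
  next
    fix z assume z: "z \<in> f -` B \<inter> A"
    obtain w where "z = p w" using \<open>surj p\<close> by auto
    with z have "w \<in> C" using C(2) by auto
    with z \<open>z = p w\<close> show "z \<in> p ` C \<inter> A" by auto
  qed
  with assms(1)[OF C(1)] show "\<exists>A'. open A' \<and> A' \<inter> A = f -` B \<inter> A" by blast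
qed

lemma surj_covering_proj: "surj covering_proj"
proof (rule surjI)
  fix z show "covering_proj (rep_circle (fst z), snd z) = z"
    by (simp add: covering_proj_def)
qed

lemma vimage_covering_proj: "covering_proj -` closed_annulus = strip"
  by (auto simp: covering_proj_def closed_annulus_def strip_def)

lemma covering_proj_mem_iff [simp]: "covering_proj z \<in> closed_annulus \<longleftrightarrow> z \<in> strip"
  using vimage_covering_proj by auto

lemma strip_covers:
  assumes "z \<in> closed_annulus"
  obtains w where "w \<in> strip" "covering_proj w = z"
  using assms surjD[OF surj_covering_proj, of z] that by auto

lemma continuous_on_annulus:
  assumes "continuous_on strip (f \<circ> covering_proj)"
  shows "continuous_on closed_annulus f"
  by (rule continuous_on_open_quotient[OF open_covering_proj_image surj_covering_proj])
     (use assms in \<open>simp_all add: vimage_covering_proj\<close>)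

text \<open>Serves the joint continuity of the isotopy. A product of quotient maps need not be a
  quotient map, but a product of open surjections is again an open surjection.\<close>

lemma continuous_on_Times_annulus:
  fixes f :: "'a::topological_space \<times> circle \<times> real \<Rightarrow> 'b::topological_space"
  assumes "continuous_on (T \<times> strip) (\<lambda>(t, w). f (t, covering_proj w))"
  shows "continuous_on (T \<times> closed_annulus) f"
proof (rule continuous_on_open_quotient[of "map_prod id covering_proj"])
  fix S :: "('a \<times> real \<times> real) set" assume "open S"
  show "open (map_prod id covering_proj ` S)"
  proof (rule open_prod_intro)
    fix p assume "p \<in> map_prod id covering_proj ` S"
    then obtain x y where xy: "(x, y) \<in> S" "p = (x, covering_proj y)" by auto
    obtain A B where AB: "open A" "open B" "(x, y) \<in> A \<times> B" "A \<times> B \<subseteq> S"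
      using open_prod_elim[OF \<open>open S\<close> xy(1)] by (metis mem_Times_iff)
    have "A \<times> covering_proj ` B \<subseteq> map_prod id covering_proj ` S"
    proof
      fix q assume "q \<in> A \<times> covering_proj ` B"
      then obtain u v where "u \<in> A" "v \<in> B" "q = map_prod id covering_proj (u, v)" by auto
      then show "q \<in> map_prod id covering_proj ` S" using AB(4) by blast
    qed
    then show "\<exists>A B. open A \<and> open B \<and> p \<in> A \<times> B \<and> A \<times> B \<subseteq> map_prod id covering_proj ` S"
      using AB xy by (intro exI[of _ A] exI[of _ "covering_proj ` B"])
         (auto simp: open_covering_proj_image)
  qed
next
  show "surj (map_prod (id :: 'a \<Rightarrow> 'a) covering_proj)"
    using surj_covering_proj by (simp add: map_prod_surj)
next
  have "map_prod id covering_proj -` (T \<times> closed_annulus) = T \<times> strip"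
    by (simp add: map_prod_vimage vimage_covering_proj)
  moreover have "f \<circ> map_prod id covering_proj = (\<lambda>(t, w). f (t, covering_proj w))"
    by auto
  ultimately show "continuous_on (map_prod id covering_proj -` (T \<times> closed_annulus))
      (f \<circ> map_prod id covering_proj)"
    using assms by simp
qed

section \<open>Equivariant maps and the annulus maps they induce\<close>

text \<open>Demanded on the whole plane, so that composing and projecting need no membership in
  \<open>strip\<close>.\<close>

definition equivariant :: "(real \<times> real \<Rightarrow> real \<times> real) \<Rightarrow> bool" where
  "equivariant F \<longleftrightarrow> (\<forall>n\<in>\<int>. \<forall>x y. F (x + n, y) = F (x, y) + (n, 0))"

definition annulus_map :: "(real \<times> real \<Rightarrow> real \<times> real) \<Rightarrow> circle \<times> real \<Rightarrow> circle \<times> real" where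
  "annulus_map F z = covering_proj (F (rep_circle (fst z), snd z))"

lemma equivariant_comp: "equivariant F \<Longrightarrow> equivariant G \<Longrightarrow> equivariant (F \<circ> G)"
  unfolding equivariant_def o_def by (simp add: plus_prod_def split_beta)

lemma covering_proj_eq_iff:
  "covering_proj z = covering_proj w \<longleftrightarrow> (\<exists>n\<in>\<int>. z = (fst w + n, snd w))"
proof
  assume "covering_proj z = covering_proj w"
  then show "\<exists>n\<in>\<int>. z = (fst w + n, snd w)"
    by (intro bexI[of _ "fst z - fst w"])
       (auto simp: covering_proj_def to_circle_eq_iff prod_eq_iff)
qed (auto simp: covering_proj_def to_circle_eq_iff)

text \<open>The representative chosen in \<open>annulus_map\<close> differs from \<open>w\<close> by
  an integer shift; \<open>F\<close> passes the shift on unchanged and the projection forgets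
  it.\<close>

lemma annulus_map_covering_proj:
  assumes "equivariant F"
  shows "annulus_map F (covering_proj w) = covering_proj (F w)"
proof -
  obtain x y where w: "w = (x, y)" by (cases w)
  define n where "n = rep_circle (to_circle x) - x"
  have "n \<in> \<int>" unfolding n_def by (rule rep_circle_to_circle)
  moreover have "rep_circle (to_circle x) = x + n" by (simp add: n_def)
  ultimately have "annulus_map F (covering_proj w) = covering_proj (F w + (n, 0))"
    using assms w by (simp add: annulus_map_def covering_proj_def equivariant_def)
  also have "\<dots> = covering_proj (F w)"
    unfolding covering_proj_eq_iff using \<open>n \<in> \<int>\<close> by (intro bexI[of _ n]) (auto simp: prod_eq_iff)
  finally show ?thesis .
qed

lemma annulus_map_cancel:
  assumes "equivariant F" "equivariant G" "\<And>w. w \<in> strip \<Longrightarrow> G (F w) = w" "z \<in> closed_annulus"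
  shows "annulus_map G (annulus_map F z) = z"
  using assms by (metis strip_covers annulus_map_covering_proj)

lemma continuous_on_annulus_map:
  assumes "equivariant F" "continuous_on strip F"
  shows "continuous_on closed_annulus (annulus_map F)"
proof (rule continuous_on_annulus)
  have "annulus_map F \<circ> covering_proj = covering_proj \<circ> F"
    using annulus_map_covering_proj[OF assms(1)] by auto
  then show "continuous_on strip (annulus_map F \<circ> covering_proj)"
    using continuous_on_compose[OF assms(2) continuous_on_covering_proj] by simp
qed

lemma annulus_map_closed_annulus:
  assumes "equivariant F" "F ` strip \<subseteq> strip"
  shows "annulus_map F ` closed_annulus \<subseteq> closed_annulus"
proof (rule image_subsetI)
  fix z assume "z \<in> closed_annulus"
  then obtain w where "w \<in> strip" "z = covering_proj w" using strip_covers by metis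
  then show "annulus_map F z \<in> closed_annulus"
    using assms by (auto simp: annulus_map_covering_proj)
qed

lemma annulus_homeo_annulus_map:
  assumes "equivariant F" "continuous_on strip F" "F ` strip \<subseteq> strip"
    and "equivariant G" "continuous_on strip G" "G ` strip \<subseteq> strip"
    and "\<And>w. w \<in> strip \<Longrightarrow> G (F w) = w" "\<And>w. w \<in> strip \<Longrightarrow> F (G w) = w"
  shows "annulus_homeo (annulus_map F)"
proof -
  have "homeomorphic_maps (top_of_set closed_annulus) (top_of_set closed_annulus)
          (annulus_map F) (annulus_map G)"
    unfolding homeomorphic_maps_def
    using annulus_map_cancel[of F G] annulus_map_cancel[of G F]
      annulus_map_closed_annulus[of F] annulus_map_closed_annulus[of G] assms
    by (auto simp: continuous_on_annulus_map continuous_map_in_subtopology)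
  then show ?thesis by (simp add: homeomorphic_maps_map)
qed

text \<open>\<open>SOME\<close> picks a point differing from \<open>w\<close> by an integer shift,
  which cancels in the displacement.\<close>

lemma displacement_covering_proj:
  assumes "equivariant F" "w \<in> strip"
  shows "displacement F (covering_proj w) = fst (F w) - fst w"
proof -
  define v where "v = (SOME v. v \<in> strip \<and> covering_proj v = covering_proj w)"
  have "v \<in> strip \<and> covering_proj v = covering_proj w"
    unfolding v_def by (rule someI[of _ w]) (use assms in simp)
  then obtain n where "n \<in> \<int>" and v: "v = (fst w + n, snd w)"
    using covering_proj_eq_iff by blast
  then have "F v = F w + (n, 0)"
    using assms(1) unfolding equivariant_def by (metis prod.collapse)
  with v show ?thesis
    unfolding displacement_def Let_def v_def[symmetric] by simp
qed

lemma continuous_on_displacement: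
  assumes "equivariant F" "continuous_on strip F"
  shows "continuous_on closed_annulus (displacement F)"
proof (rule continuous_on_annulus)
  have "continuous_on strip (\<lambda>w. fst (F w) - fst w)"
    by (intro continuous_intros assms)
  then show "continuous_on strip (displacement F \<circ> covering_proj)"
    by (rule continuous_on_eq) (simp add: displacement_covering_proj assms)
qed

subsection \<open>Integrable coboundaries\<close>

text \<open>The function \<open>u\<close> itself need not be integrable, so it is truncated first.\<close>

lemma integral_coboundary_eq_0:
  fixes u :: "'a \<Rightarrow> real"
  assumes "finite_measure M" "T \<in> measurable M M" "distr M M T = M"
    and u: "u \<in> borel_measurable M" and "integrable M (\<lambda>x. u (T x) - u x)"
  shows "(\<integral>x. u (T x) - u x \<partial>M) = 0"
proof -
  interpret finite_measure M by fact
  define k where "k = (\<lambda>(n::nat) r. max (- real n) (min (real n) r))"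
  have k_meas: "(\<lambda>x. k n (u x)) \<in> borel_measurable M" for n
    unfolding k_def using u by measurable
  have k_int: "integrable M (\<lambda>x. k n (u x))" for n
    by (rule integrable_const_bound[of _ "real n"]) (use k_meas in \<open>auto simp: k_def\<close>)
  have kT_int: "integrable M (\<lambda>x. k n (u (T x)))" for n
    using integrable_distr[OF assms(2), of "\<lambda>x. k n (u x)"] k_int[of n] assms(3) by simp
  have eq: "(\<integral>x. k n (u (T x)) - k n (u x) \<partial>M) = 0" for n
  proof -
    have "(\<integral>x. k n (u (T x)) \<partial>M) = (\<integral>x. k n (u x) \<partial>distr M M T)"
      using assms(2) k_meas by (subst integral_distr) auto
    then show ?thesis using k_int kT_int assms(3) by simp
  qed
  \<comment> \<open>Clamping to [-n, n] is 1-Lipschitz, so the integrable \<bar>u (T x) - u x\<bar>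
    dominates every truncated difference.\<close>
  have "(\<lambda>n. \<integral>x. k n (u (T x)) - k n (u x) \<partial>M) \<longlonglongrightarrow> (\<integral>x. u (T x) - u x \<partial>M)"
  proof (rule integral_dominated_convergence[where w = "\<lambda>x. \<bar>u (T x) - u x\<bar>"])
    have "(\<lambda>n. k n r) \<longlonglongrightarrow> r" for r
    proof (rule tendsto_eventually)
      obtain N where "\<bar>r\<bar> \<le> real N" using real_arch_simple by blast
      then have "k n r = r" if "n \<ge> N" for n
        using that unfolding k_def by simp
      then show "\<forall>\<^sub>F n in sequentially. k n r = r"
        by (auto simp: eventually_sequentially)
    qed
    then show "AE x in M. (\<lambda>n. k n (u (T x)) - k n (u x)) \<longlonglongrightarrow> u (T x) - u x"
      by (intro AE_I2 tendsto_diff)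
  qed (use assms k_int kT_int in \<open>auto simp: k_def\<close>)
  then show ?thesis using eq by (simp add: LIMSEQ_const_iff)
qed

subsection \<open>The spiralling maps\<close>

text \<open>In the coordinate \<open>s = log 2 (y / (1 - y))\<close> this is the translation \<open>s \<mapsto> s + a\<close>.\<close>

definition raise :: "real \<Rightarrow> real \<Rightarrow> real" where
  "raise a y = y * 2 powr a / (1 - y + y * 2 powr a)"

text \<open>Grows like \<open>ln (ln (1 / y))\<close>, slowly enough for bounded translations of \<open>s\<close> to change it
  by \<open>o(1)\<close> as \<open>y\<close> tends to \<open>0\<close>. The junk value \<open>ln 0 = 0\<close> gives \<open>winding 0 = 0\<close>.\<close>

definition winding :: "real \<Rightarrow> real" where
  "winding y = ln (1 + max 0 (- ln (2 * y)))"

text \<open>The breakpoints y = 1/2 and y = 2/3 are the heights where s = 0 and s = 1.\<close>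

definition ramp :: "real \<Rightarrow> real" where
  "ramp y = max 0 (min 1 (6 * y - 3))"

text \<open>This is s \<mapsto> s + b cos (2 pi x) conjugated by the shear along
  \<open>winding\<close>. Written in y it makes sense on the boundary too, where it is the identity
  because \<open>raise\<close> fixes 0 and 1.\<close>

definition spiral :: "real \<Rightarrow> real \<times> real \<Rightarrow> real \<times> real" where
  "spiral b z = (let y' = raise (b * cos (2 * pi * (fst z - winding (snd z)))) (snd z)
     in (fst z + (winding y' - winding (snd z)), y'))"

definition twist :: "real \<Rightarrow> real \<times> real \<Rightarrow> real \<times> real" where
  "twist t z = (fst z + t * ramp (snd z), snd z)"

section \<open>Algebra and growth estimates for \<open>raise\<close> and
  \<open>winding\<close>\<close>

lemma raise_denom_pos:
  fixes a y :: real
  assumes "0 \<le> y" "y \<le> 1"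
  shows "0 < 1 - y + y * 2 powr a"
  using assms by (cases "y = 0") (auto intro!: add_nonneg_pos mult_pos_pos)

lemma raise_mem: "0 \<le> y \<Longrightarrow> y \<le> 1 \<Longrightarrow> 0 \<le> raise a y \<and> raise a y \<le> 1"
  using raise_denom_pos[of y a] by (simp add: raise_def divide_simps)

lemma raise_0_right [simp]: "raise a 0 = 0" and raise_1_right [simp]: "raise a 1 = 1"
  and raise_0_left [simp]: "raise 0 y = y"
  by (simp_all add: raise_def)

text \<open>Translations of s compose additively; computing in y includes the endpoints 0 and 1,
  where s is infinite.\<close>

lemma raise_raise:
  assumes "0 \<le> y" "y \<le> 1"
  shows "raise a (raise b y) = raise (a + b) y"
proof -
  define D where "D = 1 - y + y * 2 powr b"
  have D: "D > 0" unfolding D_def using raise_denom_pos assms .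
  have 1: "1 - raise b y = (1 - y) / D"
    using D by (simp add: raise_def D_def[symmetric] diff_divide_eq_iff) (simp add: D_def)
  have 2: "raise b y = y * 2 powr b / D"
    by (simp add: raise_def D_def)
  have "raise a (raise b y) = raise b y * 2 powr a / (1 - raise b y + raise b y * 2 powr a)"
    by (simp only: raise_def[of a])
  also have "\<dots> = (y * 2 powr b / D * 2 powr a) / ((1 - y) / D + y * 2 powr b / D * 2 powr a)"
    unfolding 1 unfolding 2 by (rule refl)
  also have "\<dots> = ((y * 2 powr b * 2 powr a) / D) / ((1 - y + y * 2 powr b * 2 powr a) / D)"
    by (simp add: add_divide_distrib)
  also have "\<dots> = raise (a + b) y"
    using D by (simp add: raise_def powr_add ac_simps)
  finally show ?thesis .
qed

text \<open>With q = 2 powr a, the ratio of \<open>raise a y\<close> to y is q divided by a convex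
  combination of 1 and q, and q lies in [1/2, 2].\<close>

lemma raise_bounds:
  assumes "0 < y" "y \<le> 1" "\<bar>a\<bar> \<le> 1"
  shows "y / 2 \<le> raise a y" and "raise a y \<le> 2 * y"
proof -
  define q :: real where "q = 2 powr a"
  have "2 powr (-1) \<le> q" "q \<le> 2 powr 1"
    unfolding q_def using assms(3) by (intro powr_mono; simp)+
  then have q: "1 / 2 \<le> q" "q \<le> 2" by (simp_all add: powr_minus)
  have D: "0 < 1 - y + y * q" unfolding q_def using assms by (intro raise_denom_pos) auto
  have "1 - y + y * q \<le> 2 * q"
  proof -
    have "0 \<le> (1 - y) * (2 * q - 1)" "0 \<le> y * q" using assms q by simp_all
    then show ?thesis by (simp add: algebra_simps)
  qed
  then have "1 \<le> 2 * q / (1 - y + y * q)" using D by simp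
  then have "y / 2 * 1 \<le> y / 2 * (2 * q / (1 - y + y * q))"
    using assms by (intro mult_left_mono) auto
  then show "y / 2 \<le> raise a y" by (simp add: raise_def q_def)
  have "q \<le> 2 * (1 - y + y * q)"
  proof -
    have "0 \<le> (1 - y) * (2 - q)" "0 \<le> y * q" using assms q by simp_all
    then show ?thesis by (simp add: algebra_simps)
  qed
  then have "q / (1 - y + y * q) \<le> 2" using D by (simp add: divide_simps)
  then have "y * (q / (1 - y + y * q)) \<le> y * 2"
    using assms by (intro mult_left_mono) auto
  then show "raise a y \<le> 2 * y" by (simp add: raise_def q_def)
qed

text \<open>Changing y by a factor of at most 2 moves -ln (2 y) by at most ln 2 \<le> 1, and ln (1 +
  p) has slope 1 / (1 + p). The numerator 2 covers the case where the slope is taken at q, since p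
  \<le> q + 1.\<close>

lemma winding_diff_le:
  assumes "0 < y" "y / 2 \<le> y'" "y' \<le> 2 * y"
  shows "\<bar>winding y' - winding y\<bar> \<le> 2 / (1 + max 0 (- ln (2 * y)))"
proof -
  define p q where "p = max 0 (- ln (2 * y))" and "q = max 0 (- ln (2 * y'))"
  have "y' > 0" using assms by linarith
  have "ln (2 * y') \<le> ln (2 * (2 * y))" "ln y \<le> ln (2 * y')"
    using assms \<open>y' > 0\<close> by simp_all
  moreover have "ln (2 * (2 * y)) = ln 2 + ln (2 * y)" "ln (2 * y) = ln 2 + ln y"
    using assms by (simp_all only: ln_mult) (simp_all add: ln_mult)
  moreover have "ln (2::real) \<le> 1" using ln_add_one_self_le_self[of 1] by simp
  ultimately have pq: "\<bar>q - p\<bar> \<le> 1" "0 \<le> p" "0 \<le> q" unfolding p_def q_def by auto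
  have "ln (1 + q) - ln (1 + p) \<le> (q - p) / (1 + p)"
    using ln_diff_le[of "1 + q" "1 + p"] pq by simp
  also have "\<dots> \<le> 2 / (1 + p)" using pq by (intro divide_right_mono) auto
  finally have 1: "ln (1 + q) - ln (1 + p) \<le> 2 / (1 + p)" .
  have "ln (1 + p) - ln (1 + q) \<le> (p - q) / (1 + q)"
    using ln_diff_le[of "1 + p" "1 + q"] pq by simp
  also have "\<dots> \<le> 1 / (1 + q)" using pq by (intro divide_right_mono) auto
  also have "\<dots> \<le> 2 / (1 + p)" using pq by (simp add: divide_simps)
  finally show ?thesis
    using 1 unfolding winding_def p_def[symmetric] q_def[symmetric] by linarith
qed

section \<open>Continuity up to the boundary, inverses and equivariance\<close>

lemma continuous_on_winding:
  assumes "continuous_on A f" "\<And>x. x \<in> A \<Longrightarrow> f x > 0"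
  shows "continuous_on A (\<lambda>x. winding (f x))"
  unfolding winding_def
proof (intro continuous_intros assms ballI)
  fix x assume "x \<in> A"
  show "1 + max 0 (- ln (2 * f x)) \<noteq> 0" by linarith
qed (use assms(2) in force)

text \<open>The bound \<open>B\<close> supplies continuity on the lower boundary, where the angle
  \<open>fst z - winding (snd z)\<close> oscillates.\<close>

lemma continuous_on_strip_lower:
  fixes k :: "'a::t2_space \<times> real \<times> real \<Rightarrow> real"
  assumes cont: "continuous_on (T \<times> UNIV \<times> {0<..1}) k"
    and B: "(B \<longlongrightarrow> 0) (at_right 0)"
    and bound: "\<And>b x y. b \<in> T \<Longrightarrow> 0 < y \<Longrightarrow> y \<le> 1 \<Longrightarrow> \<bar>k (b, x, y)\<bar> \<le> B y"
    and zero: "\<And>b x. k (b, x, 0) = 0"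
  shows "continuous_on (T \<times> strip) k"
  unfolding continuous_on_eq_continuous_within
proof
  fix p assume p: "p \<in> T \<times> strip"
  show "continuous (at p within T \<times> strip) k"
  proof (cases "snd (snd p) > 0")
    case True
    have "open {q :: 'a \<times> real \<times> real. 0 < snd (snd q)}"
      by (intro open_Collect_less continuous_intros)
    then have "at p within T \<times> strip = at p within T \<times> UNIV \<times> {0<..1}"
      using True by (intro at_within_nhd[of _ "{q. 0 < snd (snd q)}"]) (auto simp: strip_def)
    moreover have "p \<in> T \<times> UNIV \<times> {0<..1}"
      using p True by (auto simp: strip_def)
    ultimately show ?thesis
      using cont unfolding continuous_on_eq_continuous_within by metis
  next
    case False
    \<comment> \<open>Extension by 0 turns the one-sided limit of \<open>B\<close> into continuity
      at 0 and overrides its values for y \<le> 0.\<close>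
    define C where "C y = (if y \<le> 0 then 0 else B y)" for y
    have "(C \<longlongrightarrow> 0) (at_right 0)"
      using B by (rule Lim_transform_eventually)
        (auto simp: C_def eventually_at_filter)
    moreover have "(C \<longlongrightarrow> 0) (at_left 0)"
      by (rule tendsto_eventually) (auto simp: C_def eventually_at_filter)
    ultimately have "isCont C 0"
      by (simp add: isCont_def filterlim_split_at C_def)
    have p0: "snd (snd p) = 0" using False p by (auto simp: strip_def)
    have "continuous (at p within T \<times> strip) (\<lambda>q. C (snd (snd q)))"
    proof (rule continuous_within_compose3[where g = C and f = "\<lambda>q. snd (snd q)"])
      show "isCont C (snd (snd p))" using \<open>isCont C 0\<close> p0 by simp
    qed (intro continuous_intros)
    then have "((\<lambda>q. C (snd (snd q))) \<longlongrightarrow> 0) (at p within T \<times> strip)"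
      using p0 by (simp add: continuous_within C_def)
    moreover have "norm (k q) \<le> C (snd (snd q))" if "q \<in> T \<times> strip" for q
    proof (cases q)
      case (fields b x y)
      then show ?thesis using that bound[of b y x] zero[of b x]
        by (cases "y = 0") (auto simp: strip_def C_def)
    qed
    then have "\<forall>\<^sub>F q in at p within T \<times> strip. norm (k q) \<le> C (snd (snd q))"
      by (simp add: eventually_at_filter)
    ultimately have "(k \<longlongrightarrow> 0) (at p within T \<times> strip)"
      by (rule Lim_null_comparison[rotated])
    then show ?thesis
      using p0 zero by (cases p) (simp add: continuous_within)
  qed
qed

text \<open>\<open>winding\<close> is not continuous at y = 0, but the new height \<open>r\<close>
  and the increment \<open>d\<close> are squeezed to 0 there by bounds in y alone. Negative b are
  included because they give the inverses.\<close>

lemma continuous_on_spiral: "continuous_on ({-1..1} \<times> strip) (\<lambda>(b, z). spiral b z)"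
proof -
  define r where "r = (\<lambda>(b, x, y). raise (b * cos (2 * pi * (x - winding y))) y)"
  define d where "d = (\<lambda>p. winding (r p) - winding (snd (snd p)))"
  have abs_le: "\<bar>b * cos u\<bar> \<le> 1" if "b \<in> {-1..1}" for b u :: real
    using that mult_le_one[of "\<bar>b\<bar>" "\<bar>cos u\<bar>"] by (auto simp: abs_mult)
  have r_cont: "continuous_on ({-1..1} \<times> UNIV \<times> {0<..1}) r"
    unfolding r_def raise_def split_beta
  proof (intro continuous_intros continuous_on_winding ballI)
    fix p :: "real \<times> real \<times> real" assume "p \<in> {-1..1} \<times> UNIV \<times> {0<..1}"
    then show "1 - snd (snd p) + snd (snd p) * 2 powr
        (fst p * cos (2 * pi * (fst (snd p) - winding (snd (snd p))))) \<noteq> 0"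
      using less_imp_neq[OF raise_denom_pos[of "snd (snd p)"], THEN not_sym] by (simp add: mem_Times_iff)
  qed auto
  have r_bounds: "y / 2 \<le> r (b, x, y) \<and> r (b, x, y) \<le> 2 * y"
    if "b \<in> {-1..1}" "0 < y" "y \<le> 1" for b x y
    unfolding r_def split_conv using raise_bounds[OF that(2,3) abs_le[OF that(1)]] by blast
  have "continuous_on ({-1..1} \<times> strip) r"
  proof (rule continuous_on_strip_lower[where B = "\<lambda>y. 2 * y"])
    show "((\<lambda>y::real. 2 * y) \<longlongrightarrow> 0) (at_right 0)"
      by (auto intro!: tendsto_eq_intros)
    show "\<bar>r (b, x, y)\<bar> \<le> 2 * y" if "b \<in> {-1..1}" "0 < y" "y \<le> 1" for b x y
      using r_bounds[OF that, of x] that by auto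
    show "r (b, x, 0) = 0" for b x by (simp add: r_def)
  qed (fact r_cont)
  moreover have "continuous_on ({-1..1} \<times> strip) d"
  proof (rule continuous_on_strip_lower)
    show "continuous_on ({-1..1} \<times> UNIV \<times> {0<..1}) d"
      unfolding d_def
    proof (intro continuous_intros continuous_on_winding r_cont)
      fix p :: "real \<times> real \<times> real" assume "p \<in> {-1..1} \<times> UNIV \<times> {0<..1}"
      then show "0 < r p"
        using r_bounds[of "fst p" "snd (snd p)" "fst (snd p)"] by (auto simp: mem_Times_iff)
    qed auto
    show "((\<lambda>y::real. 2 / (1 + max 0 (- ln (2 * y)))) \<longlongrightarrow> 0) (at_right 0)"
      by real_asymp
    show "\<bar>d (b, x, y)\<bar> \<le> 2 / (1 + max 0 (- ln (2 * y)))"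
      if "b \<in> {-1..1}" "0 < y" "y \<le> 1" for b x y
      using winding_diff_le[of y "r (b, x, y)"] r_bounds[OF that, of x] that by (simp add: d_def)
    show "d (b, x, 0) = 0" for b x by (simp add: d_def r_def)
  qed
  ultimately have "continuous_on ({-1..1} \<times> strip) (\<lambda>p. (fst (snd p) + d p, r p))"
    by (intro continuous_intros)
  then show ?thesis
    by (rule continuous_on_eq) (simp add: spiral_def d_def r_def Let_def split_beta)
qed

lemma spiral_mem_strip: "z \<in> strip \<Longrightarrow> spiral b z \<in> strip"
  using raise_mem by (auto simp: spiral_def strip_def Let_def)

lemma twist_mem_strip: "z \<in> strip \<Longrightarrow> twist t z \<in> strip"
  by (auto simp: twist_def strip_def)

text \<open>The sheared angle \<open>fst z - winding (snd z)\<close> is preserved by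
  \<open>spiral b\<close>, so the second map sees the same cosine and undoes the translation of
  s.\<close>

lemma spiral_minus_spiral: "z \<in> strip \<Longrightarrow> spiral (- b) (spiral b z) = z"
  by (auto simp: spiral_def Let_def strip_def raise_raise)

lemma twist_minus_twist: "twist (- t) (twist t z) = z"
  by (simp add: twist_def)

lemma continuous_on_ramp: "continuous_on S f \<Longrightarrow> continuous_on S (\<lambda>x. ramp (f x))"
  unfolding ramp_def by (intro continuous_intros)

lemma ramp_bounds: "0 \<le> ramp y" "ramp y \<le> 1"
  by (auto simp: ramp_def)

lemma continuous_on_twist: "continuous_on S (\<lambda>(t, z). twist t z)"
  unfolding twist_def split_beta by (intro continuous_intros continuous_on_ramp)

lemma equivariant_spiral: "equivariant (spiral b)"
  unfolding equivariant_def
proof (intro ballI allI)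
  fix n x y :: real assume "n \<in> \<int>"
  then obtain m where m: "n = of_int m" by (auto elim: Ints_cases)
  have "cos (2 * pi * (x + n - winding y)) = cos (2 * pi * (x - winding y) + 2 * pi * of_int m)"
    by (simp add: m algebra_simps)
  also have "\<dots> = cos (2 * pi * (x - winding y))"
    using cos.plus_of_int[of "2 * pi * (x - winding y)" m] by (simp add: mult_ac)
  finally show "spiral b (x + n, y) = spiral b (x, y) + (n, 0)"
    by (simp add: spiral_def Let_def)
qed

lemma equivariant_twist: "equivariant (twist t)"
  by (simp add: equivariant_def twist_def)

section \<open>The isotopy from the identity\<close>

text \<open>One parameter scales both the amplitude and the twist: 0 gives the identity, 1 the lift
  of the final map, and the values between give the isotopy.\<close>

definition twisted_spiral :: "real \<Rightarrow> real \<times> real \<Rightarrow> real \<times> real" where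
  "twisted_spiral t = twist t \<circ> spiral t"

lemma twisted_spiral_0: "twisted_spiral 0 z = z"
  by (simp add: twisted_spiral_def twist_def spiral_def)

lemma twisted_spiral_mem_strip: "z \<in> strip \<Longrightarrow> twisted_spiral t z \<in> strip"
  by (simp add: twisted_spiral_def spiral_mem_strip twist_mem_strip)

lemma equivariant_twisted_spiral: "equivariant (twisted_spiral t)"
  unfolding twisted_spiral_def by (intro equivariant_comp equivariant_spiral equivariant_twist)

lemma continuous_on_twisted_spiral:
  "continuous_on ({-1..1} \<times> strip) (\<lambda>(t, z). twisted_spiral t z)"
proof -
  have "continuous_on ({-1..1} \<times> strip) (\<lambda>p. (fst p, spiral (fst p) (snd p)))"
    using continuous_on_spiral by (intro continuous_intros) (simp add: split_beta)
  from continuous_on_compose2[OF continuous_on_twist[of UNIV] this] show ?thesis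
    by (simp add: twisted_spiral_def split_beta)
qed

lemma continuous_on_slice:
  fixes f :: "'a::topological_space \<times> 'b::topological_space \<Rightarrow> 'c::topological_space"
  assumes "continuous_on (T \<times> S) f" "t \<in> T"
  shows "continuous_on S (\<lambda>x. f (t, x))"
  using assms(2) by (intro continuous_on_compose2[OF assms(1)] continuous_intros) auto

lemma continuous_on_twisted_spiral_at:
  "t \<in> {-1..1} \<Longrightarrow> continuous_on strip (twisted_spiral t)"
  using continuous_on_slice[OF continuous_on_twisted_spiral] by simp

lemma annulus_homeo_twisted_spiral:
  assumes "t \<in> {0..1}"
  shows "annulus_homeo (annulus_map (twisted_spiral t))"
proof (rule annulus_homeo_annulus_map)
  show "continuous_on strip (twisted_spiral t)"
    using assms by (intro continuous_on_twisted_spiral_at) simp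
  \<comment> \<open>The explicit inverse undoes the twist first and then the spiral.\<close>
  have "continuous_on strip (\<lambda>z. spiral (- t) (twist (- t) z))"
    using continuous_on_slice[OF continuous_on_spiral, of "- t"]
      continuous_on_slice[OF continuous_on_twist[of "UNIV \<times> strip"], of "- t"] assms
    by (intro continuous_on_compose2[of strip "spiral (- t)" _ "twist (- t)"])
       (auto simp: twist_mem_strip)
  then show "continuous_on strip (spiral (- t) \<circ> twist (- t))" by (simp add: o_def)
  show "(spiral (- t) \<circ> twist (- t)) (twisted_spiral t z) = z" if "z \<in> strip" for z
    using that by (simp add: twisted_spiral_def twist_minus_twist spiral_minus_spiral)
  show "twisted_spiral t ((spiral (- t) \<circ> twist (- t)) z) = z" if "z \<in> strip" for z
    using that spiral_minus_spiral[of "twist (- t) z" "- t"] twist_minus_twist[of "- t" z]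
    by (simp add: twisted_spiral_def twist_mem_strip)
qed (auto simp: equivariant_twisted_spiral twisted_spiral_mem_strip spiral_mem_strip twist_mem_strip
  intro!: equivariant_comp equivariant_spiral equivariant_twist)

lemma annulus_map_twisted_spiral_mem:
  "z \<in> closed_annulus \<Longrightarrow> annulus_map (twisted_spiral t) z \<in> closed_annulus"
  using annulus_map_closed_annulus[OF equivariant_twisted_spiral, of t] twisted_spiral_mem_strip
  by blast

lemma isotopic_to_id_twisted_spiral: "isotopic_to_id (annulus_map (twisted_spiral 1))"
  unfolding isotopic_to_id_def homotopic_with_def
proof (intro exI conjI allI ballI)
  let ?h = "\<lambda>(t, z). annulus_map (twisted_spiral t) z"
  have "continuous_on ({0..1} \<times> closed_annulus) ?h"
  proof (rule continuous_on_Times_annulus)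
    have "continuous_on ({0..1} \<times> strip) (\<lambda>(t, z). twisted_spiral t z)"
      by (rule continuous_on_subset[OF continuous_on_twisted_spiral]) auto
    then have "continuous_on ({0..1} \<times> strip) (covering_proj \<circ> (\<lambda>(t, z). twisted_spiral t z))"
      by (intro continuous_on_compose continuous_on_covering_proj)
    then show "continuous_on ({0..1} \<times> strip)
        (\<lambda>(t, w). case (t, covering_proj w) of (t, z) \<Rightarrow> annulus_map (twisted_spiral t) z)"
      by (simp add: annulus_map_covering_proj equivariant_twisted_spiral o_def split_beta)
  qed
  moreover have "?h ` ({0..1} \<times> closed_annulus) \<subseteq> closed_annulus"
    using annulus_map_twisted_spiral_mem by auto
  ultimately show "continuous_map (prod_topology (top_of_set {0..1}) (top_of_set closed_annulus))
      (top_of_set closed_annulus) ?h"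
    by (simp add: continuous_map_in_subtopology subtopology_Times[symmetric] image_subset_iff_funcset
        flip: euclidean_product_topology)
  show "?h (0, z) = id z" for z
    by (simp add: annulus_map_def twisted_spiral_0 covering_proj_def)
  show "?h (1, z) = annulus_map (twisted_spiral 1) z" for z by simp
  show "annulus_homeo (\<lambda>z. ?h (t, z))" if "t \<in> {0..1}" for t
    using annulus_homeo_twisted_spiral[OF that] by simp
qed

subsection \<open>The orbits joining the two boundary circles\<close>

text \<open>The inverse of s = log 2 (y / (1 - y)).\<close>

definition level :: "real \<Rightarrow> real" where
  "level s = 2 powr s / (1 + 2 powr s)"

lemma one_add_powr_pos: "0 < 1 + (2::real) powr s"
  by (intro add_pos_pos) simp_all

lemma level_pos: "0 < level s" and level_less_1: "level s < 1"
  using one_add_powr_pos[of s] by (simp_all add: level_def divide_simps)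

lemma raise_level: "raise a (level s) = level (s + a)"
proof -
  define D :: real where "D = 1 + 2 powr s"
  have D: "D > 0" unfolding D_def by (rule one_add_powr_pos)
  have "1 - level s = 1 / D"
    using D by (simp add: level_def D_def[symmetric] diff_divide_eq_iff) (simp add: D_def)
  then have "raise a (level s)
      = (2 powr s / D * 2 powr a) / (1 / D + 2 powr s / D * 2 powr a)"
    by (simp add: raise_def D_def level_def)
  also have "\<dots> = (2 powr s * 2 powr a / D) / ((1 + 2 powr s * 2 powr a) / D)"
    by (simp add: add_divide_distrib)
  also have "\<dots> = level (s + a)"
    using D by (simp add: level_def powr_add)
  finally show ?thesis .
qed

text \<open>The slope of \<open>ramp\<close> lies strictly between the levels 0 and 1, so integral
  levels meet only its constant values 0 and 1.\<close>

lemma ramp_level_Ints: "ramp (level (of_int n)) \<in> \<int>"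
proof (cases "n \<le> 0")
  case True
  then have "2 powr (of_int n :: real) \<le> 2 powr 0" by (intro powr_mono) auto
  then have "level (of_int n) \<le> 1 / 2"
    using one_add_powr_pos[of "of_int n"] by (simp add: level_def divide_simps)
  then show ?thesis by (simp add: ramp_def)
next
  case False
  then have "(2::real) powr 1 \<le> 2 powr of_int n" by (intro powr_mono) auto
  then have "level (of_int n) \<ge> 2 / 3"
    using one_add_powr_pos[of "of_int n"] by (simp add: level_def divide_simps)
  then show ?thesis by (simp add: ramp_def)
qed

lemma ramp_level_nonpos:
  assumes "s \<le> 0"
  shows "ramp (level s) = 0"
proof -
  have "2 powr s \<le> 2 powr (0::real)" using assms by (intro powr_mono) auto
  then have "level s \<le> 1 / 2"
    using one_add_powr_pos[of s] by (simp add: level_def divide_simps)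
  then show ?thesis by (simp add: ramp_def)
qed

lemma level_at_bot: "(level \<longlongrightarrow> 0) at_bot" and level_at_top: "(level \<longlongrightarrow> 1) at_top"
  unfolding level_def by real_asymp+

lemma level_mem_strip [simp]: "(x, level s) \<in> strip"
  using level_pos[of s] level_less_1[of s] by (simp add: strip_def less_imp_le)

text \<open>Adding \<open>winding\<close> to the base point undoes the shear, so that the cosine
  depends on x alone.\<close>

lemma spiral_level:
  "spiral b (x + winding (level s), level s)
    = (x + winding (level (s + b * cos (2 * pi * x))), level (s + b * cos (2 * pi * x)))"
  by (simp add: spiral_def Let_def raise_level)

abbreviation "spiral_point x s \<equiv> covering_proj (x + winding (level s), level s)"

text \<open>The image level is again integral, so the twist adds an integer, which is invisible on
  the circle. The cases needed are x = 0 and x = 1/2, with cosine 1 and -1.\<close>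

lemma annulus_map_spiral_point:
  assumes "s \<in> \<int>" "cos (2 * pi * x) \<in> \<int>"
  shows "annulus_map (twisted_spiral 1) (spiral_point x s) = spiral_point x (s + cos (2 * pi * x))"
proof -
  have "s + cos (2 * pi * x) \<in> \<int>" using assms by simp
  then obtain n where n: "s + cos (2 * pi * x) = of_int n" by (auto elim: Ints_cases)
  have "twisted_spiral 1 (x + winding (level s), level s)
      = (x + winding (level (of_int n)) + ramp (level (of_int n)), level (of_int n))"
    by (simp add: twisted_spiral_def spiral_level twist_def n)
  then show ?thesis
    using ramp_level_Ints[of n] n
    by (auto simp: annulus_map_covering_proj[OF equivariant_twisted_spiral] covering_proj_eq_iff)
qed

lemma annulus_map_funpow_spiral_point:
  assumes "s \<in> \<int>" "cos (2 * pi * x) \<in> \<int>"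
  shows "(annulus_map (twisted_spiral 1) ^^ k) (spiral_point x s)
    = spiral_point x (s + real k * cos (2 * pi * x))"
proof (induction k)
  case (Suc k)
  then show ?case
    using annulus_map_spiral_point[of "s + real k * cos (2 * pi * x)" x] assms
    by (simp add: algebra_simps)
qed simp

text \<open>The circle is the image of the compact interval \<open>{0..1}\<close>, so the tube lemma applies.\<close>

lemma annulus_nbhd_circleD:
  assumes "annulus_nbhd (UNIV \<times> {c}) U" "0 \<le> c" "c \<le> 1"
  obtains A where "open A" "c \<in> A" "\<And>z. z \<in> closed_annulus \<Longrightarrow> snd z \<in> A \<Longrightarrow> z \<in> U"
proof -
  obtain W where W: "open W" "UNIV \<times> {c} \<subseteq> W" "closed_annulus \<inter> W \<subseteq> U"
    using assms by (auto simp: annulus_nbhd_def openin_open)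
  \<comment> \<open>The coordinates are swapped because \<open>tube_lemma\<close> expects the
    compact factor second.\<close>
  define W' where "W' = (\<lambda>(y, x). (to_circle x, y)) -` W"
  have "continuous_on UNIV (\<lambda>(y::real, x). (to_circle x, y))"
    unfolding split_beta
    by (intro continuous_intros continuous_on_compose2[OF continuous_on_to_circle[of UNIV]]) auto
  then have "open W'"
    unfolding W'_def using W(1) by (rule open_vimage[rotated])
  moreover have "{c} \<times> {0..1} \<subseteq> W'" using W(2) by (force simp: W'_def)
  ultimately obtain A where A: "c \<in> A" "open A" "A \<times> {0..1} \<subseteq> W'"
    using Elementary_Topology.tube_lemma[of "{0..1}" W' c] by auto
  show thesis
  proof (rule that[OF A(2,1)])
    fix z assume z: "z \<in> closed_annulus" "snd z \<in> A"
    \<comment> \<open>The fractional part is the representative lying in the interval covered by the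
      tube.\<close>
    define x where "x = frac (rep_circle (fst z))"
    have "to_circle x = fst z"
      using to_circle_eq_iff[of x "rep_circle (fst z)"] by (simp add: x_def frac_def)
    moreover have "(snd z, x) \<in> W'"
      using z A(3) frac_ge_0 less_imp_le[OF frac_lt_1] unfolding x_def
      by (intro subsetD[OF A(3)]) simp
    ultimately show "z \<in> U" using z W(3) by (auto simp: W'_def)
  qed
qed

lemma birkhoff_instability_twisted_spiral: "birkhoff_instability (annulus_map (twisted_spiral 1))"
  unfolding birkhoff_instability_def
proof (intro allI impI)
  fix U V assume "annulus_nbhd lower_boundary U" "annulus_nbhd upper_boundary V"
  then obtain A B where A: "open A" "0 \<in> A" "\<And>z. z \<in> closed_annulus \<Longrightarrow> snd z \<in> A \<Longrightarrow> z \<in> U"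
    and B: "open B" "1 \<in> B" "\<And>z. z \<in> closed_annulus \<Longrightarrow> snd z \<in> B \<Longrightarrow> z \<in> V"
    unfolding lower_boundary_def upper_boundary_def
    by (metis annulus_nbhd_circleD order_refl zero_le_one)
  obtain a where a: "\<And>s. s \<le> a \<Longrightarrow> level s \<in> A"
    using topological_tendstoD[OF level_at_bot A(1,2)] by (auto simp: eventually_at_bot_linorder)
  obtain b where b: "\<And>s. s \<ge> b \<Longrightarrow> level s \<in> B"
    using topological_tendstoD[OF level_at_top B(1,2)] by (auto simp: eventually_at_top_linorder)
  \<comment> \<open>Levels -N and N then lie in the two neighborhoods, and N \<ge> 1 makes the
    travel time 2 N positive.\<close>
  obtain N :: nat where N: "max 1 (max (- a) b) \<le> real N" using real_arch_simple by blast
  have U: "spiral_point x (- real N) \<in> U" for x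
    using a[of "- real N"] N by (intro A(3)) (simp, simp add: covering_proj_def)
  have V: "spiral_point x (real N) \<in> V" for x
    using b[of "real N"] N by (intro B(3)) (simp, simp add: covering_proj_def)
  have "(annulus_map (twisted_spiral 1) ^^ (2 * N)) (spiral_point 0 (- real N)) = spiral_point 0 (real N)"
    by (subst annulus_map_funpow_spiral_point) auto
  moreover have "(annulus_map (twisted_spiral 1) ^^ (2 * N)) (spiral_point (1/2) (real N))
      = spiral_point (1/2) (- real N)"
    by (subst annulus_map_funpow_spiral_point) auto
  moreover have "2 * N > 0" using N by simp
  ultimately show "\<exists>x\<in>U. \<exists>y\<in>V. \<exists>n\<^sub>1>0. \<exists>n\<^sub>2>0.
      (annulus_map (twisted_spiral 1) ^^ n\<^sub>1) x \<in> V \<and> (annulus_map (twisted_spiral 1) ^^ n\<^sub>2) y \<in> U"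
    using U V by metis
qed

text \<open>Up to level 0 the twist vanishes, so the lift itself, and not only its projection,
  follows the sheared vertical line over x = 0.\<close>

lemma twisted_spiral_funpow_level:
  "k \<le> n \<Longrightarrow> (twisted_spiral 1 ^^ k) (winding (level (- real n)), level (- real n))
    = (winding (level (real k - real n)), level (real k - real n))"
proof (induction k)
  case (Suc k)
  then show ?case
    using spiral_level[of 1 0 "real k - real n"]
    by (simp add: twisted_spiral_def twist_def ramp_level_nonpos algebra_simps)
qed simp

text \<open>After n steps from level -n the orbit reaches level 0, losing
  \<open>winding (level (- real n))\<close>, which grows like ln n, against the constant
  \<open>winding (level 0)\<close>.\<close>

lemma twisted_spiral_unbounded_below:
  "\<exists>z\<in>strip. \<exists>n\<ge>1. fst ((twisted_spiral 1 ^^ n) z) - fst z < - L"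
proof -
  have "filterlim (\<lambda>n. winding (level (- real n))) at_top sequentially"
    unfolding winding_def level_def by real_asymp
  then have "\<forall>\<^sub>F n in sequentially. winding (level (- real n)) > L + winding (level 0)"
    by (simp add: filterlim_at_top_dense)
  then obtain n where "n \<ge> 1" and n: "winding (level (- real n)) > L + winding (level 0)"
    using eventually_conj[OF _ eventually_ge_at_top[of "1::nat"]] eventually_happens'[OF sequentially_bot]
    by (metis (no_types, lifting))
  then show ?thesis
    using twisted_spiral_funpow_level[of n n]
    by (intro bexI[of _ "(winding (level (- real n)), level (- real n))"] exI[of _ n]) auto
qed

subsection \<open>Rotation numbers\<close>

text \<open>The twist acts last, so \<open>ramp\<close> is evaluated at the image height; the spiral
  contributes a coboundary of \<open>winding\<close>.\<close>

lemma displacement_twisted_spiral: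
  assumes "z \<in> closed_annulus"
  shows "displacement (twisted_spiral 1) z
    = ramp (snd (annulus_map (twisted_spiral 1) z))
      + (winding (snd (annulus_map (twisted_spiral 1) z)) - winding (snd z))"
proof -
  obtain w where "w \<in> strip" "covering_proj w = z" using strip_covers[OF assms] .
  then show ?thesis
    using displacement_covering_proj[OF equivariant_twisted_spiral]
      annulus_map_covering_proj[OF equivariant_twisted_spiral]
    by (auto simp: twisted_spiral_def twist_def spiral_def Let_def covering_proj_def)
qed

text \<open>Makes the coboundary integrable for every invariant measure, although
  \<open>winding\<close> itself is unbounded.\<close>

lemma winding_displacement_bounded:
  assumes "z \<in> closed_annulus"
  shows "\<bar>winding (snd (annulus_map (twisted_spiral 1) z)) - winding (snd z)\<bar> \<le> 2"
proof -
  obtain x y where w: "(x, y) \<in> strip" "covering_proj (x, y) = z"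
    using strip_covers[OF assms] by (metis surj_pair)
  define y' where "y' = raise (cos (2 * pi * (x - winding y))) y"
  have "snd (annulus_map (twisted_spiral 1) z) = y'" "snd z = y"
    using w annulus_map_covering_proj[OF equivariant_twisted_spiral, of 1 "(x, y)"]
    by (auto simp: twisted_spiral_def twist_def spiral_def Let_def covering_proj_def y'_def)
  moreover have "\<bar>winding y' - winding y\<bar> \<le> 2"
  proof (cases "y = 0")
    case False
    then have "0 < y" "y \<le> 1" using w by (auto simp: strip_def)
    then have "\<bar>winding y' - winding y\<bar> \<le> 2 / (1 + max 0 (- ln (2 * y)))"
      unfolding y'_def by (intro winding_diff_le raise_bounds) auto
    also have "\<dots> \<le> 2" by (simp add: divide_simps)
    finally show ?thesis .
  qed (simp add: y'_def)
  ultimately show ?thesis by simp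
qed

lemma borel_measurable_winding: "winding \<in> borel_measurable borel"
  unfolding winding_def by measurable

lemma borel_measurable_ramp: "ramp \<in> borel_measurable borel"
  unfolding ramp_def by measurable

text \<open>Once the coboundary has integrated to 0, the rotation number is a mean of values of
  \<open>ramp\<close>.\<close>

lemma rotation_number_twisted_spiral_mem:
  assumes "invariant_prob (annulus_map (twisted_spiral 1)) \<mu>"
  shows "rotation_number (twisted_spiral 1) \<mu> \<in> {0..1}"
proof -
  let ?f = "annulus_map (twisted_spiral 1)"
  interpret prob_space \<mu> using assms by (simp add: invariant_prob_def)
  have sets: "sets \<mu> = sets (restrict_space borel closed_annulus)"
    and f: "?f \<in> measurable \<mu> \<mu>" "distr \<mu> \<mu> ?f = \<mu>"
    using assms by (simp_all add: invariant_prob_def)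
  have space: "space \<mu> = closed_annulus"
    using sets_eq_imp_space_eq[OF sets] by (simp add: space_restrict_space)
  \<comment> \<open>Here \<open>borel\<close> is generated by the product topology, so measurability
    of \<open>snd\<close> comes from its continuity.\<close>
  have "(snd :: circle \<times> real \<Rightarrow> real) \<in> borel_measurable borel"
    by (intro borel_measurable_continuous_onI continuous_on_snd continuous_on_id)
  then have snd: "(snd :: circle \<times> real \<Rightarrow> real) \<in> borel_measurable \<mu>"
    unfolding measurable_cong_sets[OF sets refl] by (rule measurable_restrict_space1)
  have wind: "(\<lambda>z. winding (snd z)) \<in> borel_measurable \<mu>"
    by (rule measurable_compose[OF snd borel_measurable_winding])
  have ramp: "(\<lambda>z. ramp (snd (?f z))) \<in> borel_measurable \<mu>"
    by (rule measurable_compose[OF measurable_compose[OF f(1) snd] borel_measurable_ramp])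
  have int_ramp: "integrable \<mu> (\<lambda>z. ramp (snd (?f z)))"
    using ramp ramp_bounds by (intro integrable_const_bound[of _ 1]) auto
  have int_wind: "integrable \<mu> (\<lambda>z. winding (snd (?f z)) - winding (snd z))"
    using winding_displacement_bounded measurable_compose[OF f(1) wind] wind
    by (intro integrable_const_bound[of _ 2]) (auto intro!: AE_I2 simp: space)
  have "rotation_number (twisted_spiral 1) \<mu>
      = (\<integral>z. ramp (snd (?f z)) + (winding (snd (?f z)) - winding (snd z)) \<partial>\<mu>)"
    unfolding rotation_number_def
    by (rule Bochner_Integration.integral_cong) (simp_all add: space displacement_twisted_spiral)
  also have "\<dots> = (\<integral>z. ramp (snd (?f z)) \<partial>\<mu>) + (\<integral>z. winding (snd (?f z)) - winding (snd z) \<partial>\<mu>)"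
    by (rule Bochner_Integration.integral_add[OF int_ramp int_wind])
  also have "(\<integral>z. winding (snd (?f z)) - winding (snd z) \<partial>\<mu>) = 0"
    by (rule integral_coboundary_eq_0[OF finite_measure_axioms f wind int_wind])
  finally have "rotation_number (twisted_spiral 1) \<mu> = (\<integral>z. ramp (snd (?f z)) \<partial>\<mu>)" by simp
  moreover have "0 \<le> (\<integral>z. ramp (snd (?f z)) \<partial>\<mu>)"
    by (intro Bochner_Integration.integral_nonneg ramp_bounds)
  moreover have "(\<integral>z. ramp (snd (?f z)) \<partial>\<mu>) \<le> 1"
    using integral_le_const[OF int_ramp, of 1] ramp_bounds by auto
  ultimately show ?thesis by simp
qed

text \<open>The mixture giving mass 1 - r to the lower fixed point and r to the upper one is the
  image of a Bernoulli distribution.\<close>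

lemma ex_invariant_prob_rotation_number:
  assumes "r \<in> {0..1}"
  shows "\<exists>\<mu>. invariant_prob (annulus_map (twisted_spiral 1)) \<mu> \<and>
    rotation_number (twisted_spiral 1) \<mu> = r"
proof -
  let ?f = "annulus_map (twisted_spiral 1)" and ?M = "restrict_space borel closed_annulus"
  define k where "k b = covering_proj (0, of_bool b)" for b
  define \<mu> where "\<mu> = distr (measure_pmf (bernoulli_pmf r)) ?M k"
  have k_strip: "(0, of_bool b) \<in> strip" for b by (auto simp: strip_def)
  then have k: "k \<in> measurable (measure_pmf (bernoulli_pmf r)) ?M"
    by (simp add: k_def space_restrict_space)
  \<comment> \<open>The lift fixes the lower point and shifts the upper one by a full turn, which
    gives the displacements 0 and 1.\<close>
  have F_k: "twisted_spiral 1 (0, of_bool b) = (of_bool b, of_bool b)" for b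
    by (cases b) (simp_all add: twisted_spiral_def twist_def spiral_def ramp_def)
  have f_k: "?f (k b) = k b" for b
    using F_k[of b]
    by (auto simp: k_def annulus_map_covering_proj[OF equivariant_twisted_spiral] covering_proj_eq_iff)
  have disp_k: "displacement (twisted_spiral 1) (k b) = of_bool b" for b
    using F_k[of b] k_strip[of b] by (simp add: k_def displacement_covering_proj equivariant_twisted_spiral)
  have cont: "continuous_on strip (twisted_spiral 1)"
    by (rule continuous_on_twisted_spiral_at) simp
  have f: "?f \<in> measurable ?M ?M"
  proof (rule measurable_restrict_space2)
    show "?f \<in> space ?M \<rightarrow> closed_annulus"
      using annulus_map_twisted_spiral_mem by (auto simp: space_restrict_space)
    show "?f \<in> measurable ?M borel"
      by (intro borel_measurable_continuous_on_restrict continuous_on_annulus_map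
          equivariant_twisted_spiral cont)
  qed
  have disp: "displacement (twisted_spiral 1) \<in> borel_measurable ?M"
    by (intro borel_measurable_continuous_on_restrict continuous_on_displacement
        equivariant_twisted_spiral cont)
  have "invariant_prob ?f \<mu>"
    unfolding invariant_prob_def
  proof (intro conjI)
    show "prob_space \<mu>"
      unfolding \<mu>_def by (intro prob_space.prob_space_distr k measure_pmf.prob_space_axioms)
    have "distr \<mu> ?M ?f = \<mu>"
      unfolding \<mu>_def by (subst distr_distr[OF f k]) (simp add: o_def f_k)
    \<comment> \<open>As a target of \<open>distr\<close>, a measure matters only through its space
      and measurable sets, which \<open>\<mu>\<close> shares with \<open>?M\<close>.\<close>
    then show "distr \<mu> \<mu> ?f = \<mu>"
      by (metis \<mu>_def distr_cong sets_distr)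
  qed (use f in \<open>simp_all add: \<mu>_def\<close>)
  moreover have "rotation_number (twisted_spiral 1) \<mu>
      = (\<integral>b. of_bool b \<partial>measure_pmf (bernoulli_pmf r))"
    unfolding rotation_number_def \<mu>_def by (subst integral_distr[OF k disp]) (simp add: disp_k)
  then have "rotation_number (twisted_spiral 1) \<mu> = r" using assms by simp
  ultimately show ?thesis by blast
qed

theorem proposition1p1:
  "\<exists>f :: circle \<times> real \<Rightarrow> circle \<times> real.
     homeomorphic_map (top_of_set closed_annulus) (top_of_set closed_annulus) f \<and>
     isotopic_to_id f \<and>
     birkhoff_instability f \<and>
     (\<exists>F :: real \<times> real \<Rightarrow> real \<times> real.
        is_lift f F \<and>
        rotation_set f F = {0..1} \<and>
        (\<forall>L::real. L > 0 \<longrightarrow>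
           (\<exists>z\<in>strip. \<exists>n::nat. n \<ge> 1 \<and> fst ((F ^^ n) z) - fst z < - L)))"
proof (intro exI conjI)
  let ?F = "twisted_spiral 1"
  show "annulus_homeo (annulus_map ?F)" by (rule annulus_homeo_twisted_spiral) simp
  show "isotopic_to_id (annulus_map ?F)" by (rule isotopic_to_id_twisted_spiral)
  show "birkhoff_instability (annulus_map ?F)" by (rule birkhoff_instability_twisted_spiral)
  show "is_lift (annulus_map ?F) ?F"
    using continuous_on_twisted_spiral_at[of 1]
    by (auto simp: is_lift_def twisted_spiral_mem_strip annulus_map_covering_proj
        equivariant_twisted_spiral)
  show "rotation_set (annulus_map ?F) ?F = {0..1}"
    unfolding rotation_set_def
    using rotation_number_twisted_spiral_mem ex_invariant_prob_rotation_number by blast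
  show "\<forall>L>0. \<exists>z\<in>strip. \<exists>n\<ge>1. fst ((?F ^^ n) z) - fst z < - L"
    by (intro allI impI twisted_spiral_unbounded_below)
qed

end
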